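(* Let $\mathcal F=\{(x,w)\in\mathbb Z_+^n\times\mathbb R_+^d:\ \sum_{j=1}^n A_jx_j+\sum_{j=1}^d G_jw_j\le b,\ x\le u\}$ be bounded, where $A_j,G_j\in\mathbb R^m$ for all $j$, $b\in\mathbb R^m$ and $u\in\mathbb Z_+^n$, and let $P=\operatorname{conv}\mathcal F$. Let $N=\{1,\dots,n\}$ be partitioned into subsets $N_1,\dots,N_K$, and let the linking polyhedra $V_1,\dots,V_K$ and the aggregated polyhedron $Q$ be defined from these data as in the context. Then $$P=\Bigl\{(x,w)\in\mathbb R^n\times\mathbb R^d:\ \text{there exists } y\in[0,1]^{n_1+\cdots+n_K}\text{ with }(y,w)\in Q\text{ and }(x^{N_i},y^{N_i})\in V_i\text{ for all } i=1,\dots,K\Bigr\}.$$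
   Context: Notation: $x^{N_i}=(x_j)_{j\in N_i}$ is the subvector of $x$ indexed by $N_i$. For each $i=1,\dots,K$ let $$\mathcal A_i=\Bigl\{\sum_{j\in N_i}A_jx_j:\ x_j\in\{0,\dots,u_j\}\text{ for } j\in N_i\Bigr\}\subset\mathbb R^m ,$$ a finite set, let $n_i=|\mathcal A_i|$, and number its (distinct) elements as $\mathcal A_i=\{f^{N_i}_1,\dots,f^{N_i}_{n_i}\}$. To each $f^{N_i}_k$ one associates a new variable $y^{N_i}_k$; write $y^{N_i}=(y^{N_i}_1,\dots,y^{N_i}_{n_i})$ and $y=(y^{N_1},\dots,y^{N_K})$. The linking polyhedron of block $N_i$ is $$V_i=\operatorname{conv}\Bigl\{(x^{N_i},y^{N_i})\in\mathbb Z_+^{|N_i|}\times\{0,1\}^{n_i}:\ \sum_{j\in N_i}A_jx_j=\sum_{k=1}^{n_i}f^{N_i}_ky^{N_i}_k,\ \sum_{k=1}^{n_i}y^{N_i}_k=1,\ 0\le x_j\le u_j\ (j\in N_i)\Bigr\}.$$ The aggregated polyhedron is $$Q=\operatorname{conv}\Bigl\{(y,w)\in\{0,1\}^{n_1+\cdots+n_K}\times\mathbb R_+^d:\ \sum_{i=1}^K\sum_{k=1}^{n_i}f^{N_i}_ky^{N_i}_k+\sum_{j=1}^dG_jw_j\le b,\ \sum_{k=1}^{n_i}y^{N_i}_k\le1\ \text{for all } i=1,\dots,K\Bigr\}.$$ *)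

theory Defs
  imports "HOL-Analysis.Analysis" "HOL-Library.Function_Algebras"
begin

text \<open>
  All dimensions are natural numbers that may depend on the data (and may be 0), so vectors are
  real-valued functions that vanish outside a given index set. The pointwise real vector space
  structure on functions makes the library's \<^const>\<open>hull\<close> with \<^const>\<open>convex\<close> available for
  them and for pairs of them. The order \<open>\<le>\<close> on functions is the library's pointwise order.
\<close>

instantiation "fun" :: (type, real_vector) real_vector
begin

definition scaleR_fun :: "real \<Rightarrow> ('a \<Rightarrow> 'b) \<Rightarrow> 'a \<Rightarrow> 'b"
  where "scaleR_fun c f = (\<lambda>x. c *\<^sub>R f x)"

instance
  by standard (simp_all add: scaleR_fun_def fun_eq_iff plus_fun_def scaleR_add_right scaleR_add_left)

end

definition coord_space :: "'i set \<Rightarrow> ('i \<Rightarrow> real) set"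
  where "coord_space I = {x. \<forall>i. i \<notin> I \<longrightarrow> x i = 0}"

definition subvec :: "('i \<Rightarrow> real) \<Rightarrow> 'i set \<Rightarrow> 'i \<Rightarrow> real"
  where "subvec x I = (\<lambda>i. if i \<in> I then x i else 0)"

text \<open>
  Boundedness of a subset of the Euclidean space \<open>\<real>\<^sup>n \<times> \<real>\<^sup>d\<close>. The library's \<^const>\<open>bounded\<close> is not
  suitable here: its metric on functions is the (bounded) product metric.
\<close>

definition euclidean_bounded ::
    "nat \<Rightarrow> nat \<Rightarrow> ((nat \<Rightarrow> real) \<times> (nat \<Rightarrow> real)) set \<Rightarrow> bool"
  where "euclidean_bounded n d S \<longleftrightarrow>
    (\<exists>B. \<forall>(x, w) \<in> S. sqrt ((\<Sum>j=1..n. (x j)\<^sup>2) + (\<Sum>j=1..d. (w j)\<^sup>2)) \<le> B)"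

definition feasible_set ::
    "nat \<Rightarrow> nat \<Rightarrow> (nat \<Rightarrow> nat \<Rightarrow> real) \<Rightarrow> (nat \<Rightarrow> nat \<Rightarrow> real) \<Rightarrow> (nat \<Rightarrow> real) \<Rightarrow> (nat \<Rightarrow> nat)
      \<Rightarrow> ((nat \<Rightarrow> real) \<times> (nat \<Rightarrow> real)) set"
  where "feasible_set n d A G b u =
    {(x, w). x \<in> coord_space {1..n} \<and> (\<forall>j\<in>{1..n}. x j \<in> \<nat>) \<and>
             w \<in> coord_space {1..d} \<and> (\<forall>j\<in>{1..d}. 0 \<le> w j) \<and>
             (\<Sum>j=1..n. x j *\<^sub>R A j) + (\<Sum>j=1..d. w j *\<^sub>R G j) \<le> b \<and>
             (\<forall>j\<in>{1..n}. x j \<le> real (u j))}"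

definition block_values ::
    "(nat \<Rightarrow> nat \<Rightarrow> real) \<Rightarrow> (nat \<Rightarrow> nat) \<Rightarrow> nat set \<Rightarrow> (nat \<Rightarrow> real) set"
  where "block_values A u I =
    {(\<Sum>j\<in>I. real (x j) *\<^sub>R A j) | x :: nat \<Rightarrow> nat. \<forall>j\<in>I. x j \<in> {0..u j}}"

text \<open>The linking polyhedron of a block \<open>I\<close> with values \<open>f 1, \<dots>, f l\<close>.\<close>

definition linking_polyhedron ::
    "(nat \<Rightarrow> nat \<Rightarrow> real) \<Rightarrow> (nat \<Rightarrow> nat) \<Rightarrow> nat set \<Rightarrow> nat \<Rightarrow> (nat \<Rightarrow> nat \<Rightarrow> real)
      \<Rightarrow> ((nat \<Rightarrow> real) \<times> (nat \<Rightarrow> real)) set"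
  where "linking_polyhedron A u I l f = convex hull
    {(x, y). x \<in> coord_space I \<and> (\<forall>j\<in>I. x j \<in> \<nat>) \<and>
             y \<in> coord_space {1..l} \<and> (\<forall>k\<in>{1..l}. y k \<in> {0, 1}) \<and>
             (\<Sum>j\<in>I. x j *\<^sub>R A j) = (\<Sum>k=1..l. y k *\<^sub>R f k) \<and>
             (\<Sum>k=1..l. y k) = 1 \<and>
             (\<forall>j\<in>I. 0 \<le> x j \<and> x j \<le> real (u j))}"

text \<open>
  Index set of the variables \<open>y\<close>; block \<open>i\<close> of \<open>y\<close> is \<open>\<lambda>k. y (i, k)\<close>.
\<close>

definition y_index :: "nat \<Rightarrow> (nat \<Rightarrow> nat) \<Rightarrow> (nat \<times> nat) set"
  where "y_index K l = (SIGMA i:{1..K}. {1..l i})"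

definition aggregated_polyhedron ::
    "nat \<Rightarrow> (nat \<Rightarrow> nat \<Rightarrow> real) \<Rightarrow> (nat \<Rightarrow> real) \<Rightarrow> nat \<Rightarrow> (nat \<Rightarrow> nat) \<Rightarrow> (nat \<Rightarrow> nat \<Rightarrow> nat \<Rightarrow> real)
      \<Rightarrow> ((nat \<times> nat \<Rightarrow> real) \<times> (nat \<Rightarrow> real)) set"
  where "aggregated_polyhedron d G b K l f = convex hull
    {(y, w). y \<in> coord_space (y_index K l) \<and> (\<forall>p\<in>y_index K l. y p \<in> {0, 1}) \<and>
             w \<in> coord_space {1..d} \<and> (\<forall>j\<in>{1..d}. 0 \<le> w j) \<and>
             (\<Sum>i=1..K. \<Sum>k=1..l i. y (i, k) *\<^sub>R f i k) + (\<Sum>j=1..d. w j *\<^sub>R G j) \<le> b \<and>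
             (\<forall>i\<in>{1..K}. (\<Sum>k=1..l i. y (i, k)) \<le> 1)}"

end

theory Submission
  imports Defs
begin

text \<open>
  The inclusion \<open>\<subseteq>\<close> only has to be checked at feasible points, the right-hand side being convex:
  a feasible \<open>(x, w)\<close> determines in each block the value \<open>\<Sum>j\<in>N i. x j *\<^sub>R A j\<close>, and \<open>y\<close> is the
  indicator of the position of that value in the enumeration \<open>f i\<close>.

  For \<open>\<supseteq>\<close>, call the fibre of a block value the set of integer points of the block attaining it.
  A point \<open>(x, y)\<close> of a linking polyhedron is described by its \<open>y\<close> part up to a free choice inside
  the convex hulls of the fibres: grouping the generating points in a convex combination by their
  block value gives \<open>x = (\<Sum>k. y k *\<^sub>R \<xi> k)\<close> with \<open>\<xi> k\<close> in the convex hull of the fibre of \<open>f k\<close>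
  (\<open>linking_polyhedron_decompose\<close>). Fix such \<open>\<xi> i k\<close> for all blocks. Now \<open>x\<close> is a linear function
  of \<open>y\<close>, and membership in the linking polyhedra forces all block sums of \<open>y\<close> to be 1. It is
  enough to see where the generating points of the aggregated polyhedron go (\<open>aggregated_lift\<close>).
  Such a point with all block sums equal to 1 selects one value in each block so that the selected
  values together with \<open>w\<close> satisfy the constraint. Any choice of one point in each selected fibre
  is therefore feasible with \<open>w\<close> (\<open>sum_fibre_points_feasible\<close>), and since a sum of convex hulls is
  the convex hull of the sums, the same holds, up to convex hull, for the points \<open>\<xi> i k\<close>.
\<close>

section \<open>Vectors as functions\<close>

lemma scaleR_fun_apply: "(c *\<^sub>R f) x = c *\<^sub>R f x"
  by (simp add: scaleR_fun_def)

lemma sum_fun_apply: "(\<Sum>i\<in>I. f i) x = (\<Sum>i\<in>I. f i x)"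
  by (induction I rule: infinite_finite_induct) auto

lemma convex_coord_space: "convex (coord_space I)"
  by (auto simp: convex_def coord_space_def scaleR_fun_apply)

lemma subvec_add: "subvec (x + y) I = subvec x I + subvec y I"
  by (auto simp: subvec_def fun_eq_iff)

lemma subvec_scaleR: "subvec (c *\<^sub>R x) I = c *\<^sub>R subvec x I"
  by (auto simp: subvec_def fun_eq_iff scaleR_fun_apply)

lemma subvec_in_coord_space: "subvec x I \<in> coord_space I"
  by (auto simp: subvec_def coord_space_def)

lemma sum_in_disjoint_blocks:
  fixes s :: "'a \<Rightarrow> 'i \<Rightarrow> real"
  assumes "finite I" "disjoint_family_on N I" "\<And>i. i \<in> I \<Longrightarrow> s i \<in> coord_space (N i)"
    and "i \<in> I" "j \<in> N i"
  shows "(\<Sum>i\<in>I. s i) j = s i j"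
proof -
  have "s i' j = 0" if "i' \<in> I" "i' \<noteq> i" for i'
  proof -
    have "j \<notin> N i'"
      using assms(2,4,5) that by (auto simp: disjoint_family_on_def)
    then show ?thesis
      using assms(3)[OF that(1)] by (simp add: coord_space_def)
  qed
  then have "(\<Sum>i'\<in>I. s i' j) = (\<Sum>i'\<in>I. if i' = i then s i j else 0)"
    by (intro sum.cong) auto
  then show ?thesis
    using assms by (simp add: sum_fun_apply)
qed

lemma sum_coord_space:
  fixes s :: "'a \<Rightarrow> 'i \<Rightarrow> real"
  assumes "\<And>i. i \<in> I \<Longrightarrow> s i \<in> coord_space (N i)"
  shows "(\<Sum>i\<in>I. s i) \<in> coord_space (\<Union>i\<in>I. N i)"
  using assms by (auto simp: coord_space_def sum_fun_apply intro!: sum.neutral)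

lemma sum_subvec_blocks:
  assumes "finite I" "disjoint_family_on N I" "x \<in> coord_space (\<Union>i\<in>I. N i)"
  shows "(\<Sum>i\<in>I. subvec x (N i)) = x"
proof
  fix j
  show "(\<Sum>i\<in>I. subvec x (N i)) j = x j"
  proof (cases "j \<in> (\<Union>i\<in>I. N i)")
    case True
    then obtain i where "i \<in> I" "j \<in> N i" by blast
    then show ?thesis
      using sum_in_disjoint_blocks[OF assms(1,2), of "\<lambda>i. subvec x (N i)" i j]
      by (simp add: subvec_in_coord_space) (simp add: subvec_def)
  next
    case False
    then show ?thesis
      using assms(3) sum_coord_space[of I "\<lambda>i. subvec x (N i)" N]
      by (auto simp: coord_space_def subvec_in_coord_space[unfolded coord_space_def, simplified])
  qed
qed

lemma sum_in_convex_hull_sums: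
  fixes S :: "'a \<Rightarrow> 'b :: real_vector set"
  assumes "finite I" "\<And>i. i \<in> I \<Longrightarrow> \<xi> i \<in> convex hull (S i)"
  shows "(\<Sum>i\<in>I. \<xi> i) \<in> convex hull {\<Sum>i\<in>I. s i | s. \<forall>i\<in>I. s i \<in> S i}"
proof -
  have "(\<Sum>i\<in>I. \<xi> i) \<in> (\<Sum>i\<in>I. convex hull (S i))"
    using assms by (auto simp: set_sum_alt)
  also have "\<dots> = convex hull {\<Sum>i\<in>I. s i | s. \<forall>i\<in>I. s i \<in> S i}"
    by (simp add: convex_hull_set_sum[symmetric] set_sum_alt assms(1))
  finally show ?thesis .
qed

lemma unit_vector_of_binary_sum_one:
  fixes y :: "'a \<Rightarrow> real"
  assumes "finite I" "\<forall>k\<in>I. y k \<in> {0, 1}" "(\<Sum>k\<in>I. y k) = 1"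
  obtains k where "k \<in> I" "\<And>k'. k' \<in> I \<Longrightarrow> y k' = (if k' = k then 1 else 0)"
proof -
  obtain k where k: "k \<in> I" "y k = 1"
    using assms by (metis insertE singletonD sum.neutral zero_neq_one)
  have "(\<Sum>k\<in>I - {k}. y k) = 0"
    using assms k by (simp add: sum_diff1)
  moreover have "\<forall>k'\<in>I - {k}. 0 \<le> y k'"
    using assms(2) by fastforce
  ultimately have "\<forall>k'\<in>I - {k}. y k' = 0"
    using assms(1) by (subst (asm) sum_nonneg_eq_0_iff) auto
  then show thesis
    using that[of k] k by auto
qed

lemma sum_unit_vector:
  fixes g :: "'a \<Rightarrow> 'b :: real_vector"
  assumes "finite I" "k \<in> I" "\<And>k'. k' \<in> I \<Longrightarrow> y k' = (if k' = k then 1 else 0)"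
  shows "(\<Sum>k\<in>I. y k *\<^sub>R g k) = g k"
proof -
  have "(\<Sum>k'\<in>I. y k' *\<^sub>R g k') = (\<Sum>k'\<in>I. if k' = k then g k else 0)"
    using assms by (intro sum.cong) auto
  then show ?thesis using assms by simp
qed

section \<open>Fibres of block values and the linking polyhedron\<close>

definition value_fibre ::
    "(nat \<Rightarrow> nat \<Rightarrow> real) \<Rightarrow> (nat \<Rightarrow> nat) \<Rightarrow> nat set \<Rightarrow> (nat \<Rightarrow> real) \<Rightarrow> (nat \<Rightarrow> real) set"
  where "value_fibre A u I v =
    {x \<in> coord_space I. (\<forall>j\<in>I. x j \<in> \<nat> \<and> x j \<le> real (u j)) \<and> (\<Sum>j\<in>I. x j *\<^sub>R A j) = v}"

lemma value_fibre_nonempty: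
  assumes "v \<in> block_values A u I"
  shows "value_fibre A u I v \<noteq> {}"
proof -
  obtain x :: "nat \<Rightarrow> nat" where
    x: "\<forall>j\<in>I. x j \<in> {0..u j}" "v = (\<Sum>j\<in>I. real (x j) *\<^sub>R A j)"
    using assms by (auto simp: block_values_def)
  have "subvec (\<lambda>j. real (x j)) I \<in> value_fibre A u I v"
    using x by (auto simp: value_fibre_def subvec_in_coord_space) (auto simp: subvec_def)
  then show ?thesis by blast
qed

lemma block_value_of_integer_point:
  assumes "\<forall>j\<in>I. x j \<in> \<nat> \<and> x j \<le> real (u j)"
  shows "(\<Sum>j\<in>I. x j *\<^sub>R A j) \<in> block_values A u I"
proof -
  have *: "real (nat \<lfloor>x j\<rfloor>) = x j" if "j \<in> I" for j
    using assms that by (auto simp: Nats_def)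
  then have "\<forall>j\<in>I. nat \<lfloor>x j\<rfloor> \<in> {0..u j}"
    using assms by (metis atLeastAtMost_iff of_nat_le_iff zero_le)
  moreover have "(\<Sum>j\<in>I. x j *\<^sub>R A j) = (\<Sum>j\<in>I. real (nat \<lfloor>x j\<rfloor>) *\<^sub>R A j)"
    using * by simp
  ultimately show ?thesis
    unfolding block_values_def by (intro CollectI exI[of _ "\<lambda>j. nat \<lfloor>x j\<rfloor>"]) simp
qed

text \<open>
  Normalising the weights gives \<open>r\<close>, except for total weight 0, in which case any point of \<open>C\<close>
  will do; the existential form hides this distinction.
\<close>

lemma convex_merge:
  assumes "convex C" "p \<in> C" "q \<in> C" "0 \<le> a" "0 \<le> (c::real)"
  shows "\<exists>r\<in>C. (a + c) *\<^sub>R r = a *\<^sub>R p + c *\<^sub>R q"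
proof (cases "a + c = 0")
  case True
  then have "a = 0" "c = 0" using assms by linarith+
  then show ?thesis using assms by auto
next
  case False
  let ?r = "(a / (a + c)) *\<^sub>R p + (c / (a + c)) *\<^sub>R q"
  have "?r \<in> C"
    using assms False by (intro convexD) (auto simp: add_divide_distrib[symmetric])
  moreover have "(a + c) *\<^sub>R ?r = a *\<^sub>R p + c *\<^sub>R q"
    using False by (simp add: scaleR_add_right)
  ultimately show ?thesis by blast
qed

lemma convex_hull_pair_induct [consumes 1, case_names vertex combination]:
  assumes "(x, y) \<in> convex hull S"
    and "\<And>x y. (x, y) \<in> S \<Longrightarrow> P x y"
    and "\<And>x y x' y' a c. P x y \<Longrightarrow> P x' y' \<Longrightarrow> 0 \<le> a \<Longrightarrow> 0 \<le> c \<Longrightarrow> a + c = 1 \<Longrightarrow>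
      P (a *\<^sub>R x + c *\<^sub>R x') (a *\<^sub>R y + c *\<^sub>R y')"
  shows "P x y"
proof -
  have "convex {p. P (fst p) (snd p)}"
    unfolding convex_def using assms(3) by auto
  then show ?thesis
    using hull_induct[OF assms(1), of "\<lambda>p. P (fst p) (snd p)"] assms(2) by auto
qed

text \<open>
  The points \<open>(x, y)\<close> of the stated form are a convex set containing the generating points. For convexity,
  \<open>\<xi> k\<close> and \<open>\<xi>' k\<close> are averaged with weights proportional to the two masses on the value \<open>f k\<close>;
  fibres are nonempty, so \<open>\<xi> k\<close> can be chosen even when \<open>y k = 0\<close>.
\<close>

lemma linking_polyhedron_decompose:
  assumes "(x, y) \<in> linking_polyhedron A u I l f"
    and fibres: "\<And>k. k \<in> {1..l} \<Longrightarrow> value_fibre A u I (f k) \<noteq> {}"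
  shows "(\<Sum>k=1..l. y k) = 1 \<and> (\<forall>k\<in>{1..l}. 0 \<le> y k) \<and>
    (\<exists>\<xi>. (\<forall>k\<in>{1..l}. \<xi> k \<in> convex hull (value_fibre A u I (f k))) \<and>
         x = (\<Sum>k=1..l. y k *\<^sub>R \<xi> k))"
  using assms(1) unfolding linking_polyhedron_def
proof (induction rule: convex_hull_pair_induct)
  case (vertex x y)
  then have bin: "\<forall>k\<in>{1..l}. y k \<in> {0, 1}" and sum1: "(\<Sum>k=1..l. y k) = 1"
    by auto
  obtain k where k: "k \<in> {1..l}" "\<And>k'. k' \<in> {1..l} \<Longrightarrow> y k' = (if k' = k then 1 else 0)"
    using unit_vector_of_binary_sum_one[OF finite_atLeastAtMost bin sum1] by blast
  have unit: "(\<Sum>k=1..l. y k *\<^sub>R g k) = g k" for g :: "nat \<Rightarrow> nat \<Rightarrow> real"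
    using k by (intro sum_unit_vector) auto
  have x: "x \<in> value_fibre A u I (f k)"
    using vertex unit[of f] by (auto simp: value_fibre_def)
  \<comment> \<open>Only \<open>\<xi> k\<close> has a nonzero coefficient; elsewhere any point of the fibre serves.\<close>
  define \<xi> where "\<xi> k' = (if k' = k then x else SOME p. p \<in> value_fibre A u I (f k'))" for k'
  have "\<xi> k' \<in> convex hull (value_fibre A u I (f k'))" if "k' \<in> {1..l}" for k'
    using x fibres[OF that] by (auto simp: \<xi>_def some_in_eq intro!: hull_inc)
  moreover have "x = (\<Sum>k=1..l. y k *\<^sub>R \<xi> k)"
    unfolding unit by (simp add: \<xi>_def)
  moreover have "\<forall>k\<in>{1..l}. 0 \<le> y k"
    using k(2) by simp
  ultimately show ?case
    using sum1 by blast
next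
  case (combination x y x' y' a c)
  obtain \<xi> \<xi>' where
    \<xi>: "\<And>k. k \<in> {1..l} \<Longrightarrow> \<xi> k \<in> convex hull (value_fibre A u I (f k))"
      "x = (\<Sum>k=1..l. y k *\<^sub>R \<xi> k)" and
    \<xi>': "\<And>k. k \<in> {1..l} \<Longrightarrow> \<xi>' k \<in> convex hull (value_fibre A u I (f k))"
      "x' = (\<Sum>k=1..l. y' k *\<^sub>R \<xi>' k)"
    using combination(1,2) by blast
  have nonneg: "0 \<le> a * y k" "0 \<le> c * y' k" if "k \<in> {1..l}" for k
    using combination that by auto
  have "\<exists>r. r \<in> convex hull (value_fibre A u I (f k)) \<and>
      (a * y k + c * y' k) *\<^sub>R r = (a * y k) *\<^sub>R \<xi> k + (c * y' k) *\<^sub>R \<xi>' k" if "k \<in> {1..l}" for k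
    using convex_merge[OF convex_convex_hull \<xi>(1)[OF that] \<xi>'(1)[OF that] nonneg[OF that]]
    by blast
  then obtain r where r: "\<And>k. k \<in> {1..l} \<Longrightarrow> r k \<in> convex hull (value_fibre A u I (f k))"
    "\<And>k. k \<in> {1..l} \<Longrightarrow>
      (a * y k + c * y' k) *\<^sub>R r k = (a * y k) *\<^sub>R \<xi> k + (c * y' k) *\<^sub>R \<xi>' k"
    by metis
  have "a *\<^sub>R x + c *\<^sub>R x' = (\<Sum>k=1..l. (a * y k) *\<^sub>R \<xi> k + (c * y' k) *\<^sub>R \<xi>' k)"
    by (simp add: \<xi>(2) \<xi>'(2) scaleR_sum_right sum.distrib)
  also have "\<dots> = (\<Sum>k=1..l. (a *\<^sub>R y + c *\<^sub>R y') k *\<^sub>R r k)"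
    by (rule sum.cong) (simp_all add: r(2) scaleR_fun_apply)
  finally have "a *\<^sub>R x + c *\<^sub>R x' = (\<Sum>k=1..l. (a *\<^sub>R y + c *\<^sub>R y') k *\<^sub>R r k)" .
  moreover have "(\<Sum>k=1..l. (a *\<^sub>R y + c *\<^sub>R y') k) = 1"
    using combination by (simp add: scaleR_fun_apply sum.distrib sum_distrib_left[symmetric])
  moreover have "\<forall>k\<in>{1..l}. 0 \<le> (a *\<^sub>R y + c *\<^sub>R y') k"
    using nonneg by (simp add: scaleR_fun_apply add_nonneg_nonneg)
  ultimately show ?case
    using r(1) by blast
qed

section \<open>From the aggregated polyhedron to the feasible set\<close>

text \<open>
  Taking one point from each selected fibre gives a feasible point, because only the block values
  enter the constraint.
\<close>

lemma sum_fibre_points_feasible: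
  fixes K :: nat
  assumes disj: "disjoint_family_on N {1..K}" and cover: "(\<Union>i\<in>{1..K}. N i) = {1..n}"
    and s: "\<And>i. i \<in> {1..K} \<Longrightarrow> s i \<in> value_fibre A u (N i) (v i)"
    and w: "w \<in> coord_space {1..d}" "\<forall>j\<in>{1..d}. 0 \<le> w j"
    and le: "(\<Sum>i=1..K. v i) + (\<Sum>j=1..d. w j *\<^sub>R G j) \<le> b"
  shows "(\<Sum>i=1..K. s i, w) \<in> feasible_set n d A G b u"
proof -
  let ?x = "\<Sum>i=1..K. s i"
  have cs: "s i \<in> coord_space (N i)" if "i \<in> {1..K}" for i
    using s[OF that] by (simp add: value_fibre_def)
  have eq: "?x j = s i j" if "i \<in> {1..K}" "j \<in> N i" for i j
    using sum_in_disjoint_blocks[of "{1..K}" N s i j] disj cs that by simp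
  have fin: "finite (N i)" if "i \<in> {1..K}" for i
    using cover that by (metis UN_upper finite_atLeastAtMost finite_subset)
  have "(\<Sum>j=1..n. ?x j *\<^sub>R A j) = (\<Sum>i=1..K. \<Sum>j\<in>N i. ?x j *\<^sub>R A j)"
    unfolding cover[symmetric] using disj fin
    by (intro sum.UNION_disjoint) (auto simp: disjoint_family_on_def)
  also have "\<dots> = (\<Sum>i=1..K. \<Sum>j\<in>N i. s i j *\<^sub>R A j)"
    using eq by (intro sum.cong) auto
  also have "\<dots> = (\<Sum>i=1..K. v i)"
    using s by (intro sum.cong) (auto simp: value_fibre_def)
  finally have "(\<Sum>j=1..n. ?x j *\<^sub>R A j) = (\<Sum>i=1..K. v i)" .
  moreover have "?x \<in> coord_space {1..n}"
    using sum_coord_space[of "{1..K}" s N] cs cover by simp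
  moreover have "?x j \<in> \<nat> \<and> ?x j \<le> real (u j)" if j: "j \<in> {1..n}" for j
  proof -
    obtain i where i: "i \<in> {1..K}" "j \<in> N i"
      using j cover by blast
    have "s i j \<in> \<nat> \<and> s i j \<le> real (u j)"
      using s[OF i(1)] i(2) by (simp add: value_fibre_def)
    then show ?thesis
      unfolding eq[OF i] .
  qed
  ultimately show ?thesis
    unfolding feasible_set_def using w le by (intro CollectI case_prodI conjI) simp_all
qed

text \<open>
  Points with all block sums equal to 1 form a face of the aggregated polyhedron, since every block
  sum is at most 1. Carrying the bound through the induction therefore makes it possible to
  restrict attention to the generating points on that face.
\<close>

lemma aggregated_lift:
  assumes disj: "disjoint_family_on N {1..K}" and cover: "(\<Union>i\<in>{1..K}. N i) = {1..n}"
    and \<xi>: "\<And>i k. i \<in> {1..K} \<Longrightarrow> k \<in> {1..l i} \<Longrightarrow>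
      \<xi> i k \<in> convex hull (value_fibre A u (N i) (f i k))"
    and "(y, w) \<in> aggregated_polyhedron d G b K l f"
    and "\<forall>i\<in>{1..K}. (\<Sum>k=1..l i. y (i, k)) = 1"
  shows "(\<Sum>i=1..K. \<Sum>k=1..l i. y (i, k) *\<^sub>R \<xi> i k, w) \<in> convex hull (feasible_set n d A G b u)"
proof -
  have "(\<forall>i\<in>{1..K}. (\<Sum>k=1..l i. y (i, k)) \<le> 1) \<and>
    ((\<forall>i\<in>{1..K}. (\<Sum>k=1..l i. y (i, k)) = 1) \<longrightarrow>
      (\<Sum>i=1..K. \<Sum>k=1..l i. y (i, k) *\<^sub>R \<xi> i k, w) \<in> convex hull (feasible_set n d A G b u))"
    using assms(4) unfolding aggregated_polyhedron_def
  proof (induction rule: convex_hull_pair_induct)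
    case (vertex y w)
    then have bin: "\<forall>p\<in>y_index K l. y p \<in> {0, 1}"
      and w: "w \<in> coord_space {1..d}" "\<forall>j\<in>{1..d}. 0 \<le> w j"
      and le: "(\<Sum>i=1..K. \<Sum>k=1..l i. y (i, k) *\<^sub>R f i k) + (\<Sum>j=1..d. w j *\<^sub>R G j) \<le> b"
      and sum_le: "\<forall>i\<in>{1..K}. (\<Sum>k=1..l i. y (i, k)) \<le> 1"
      by auto
    have "(\<Sum>i=1..K. \<Sum>k=1..l i. y (i, k) *\<^sub>R \<xi> i k, w) \<in> convex hull (feasible_set n d A G b u)"
      if sum1: "\<forall>i\<in>{1..K}. (\<Sum>k=1..l i. y (i, k)) = 1"
    proof -
      have "\<exists>k. k \<in> {1..l i} \<and> (\<forall>k'\<in>{1..l i}. y (i, k') = (if k' = k then 1 else 0))"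
        if i: "i \<in> {1..K}" for i
      proof -
        have bin_i: "\<forall>k\<in>{1..l i}. y (i, k) \<in> {0, 1}"
          using bin i unfolding y_index_def by blast
        obtain k where "k \<in> {1..l i}"
          "\<And>k'. k' \<in> {1..l i} \<Longrightarrow> y (i, k') = (if k' = k then 1 else 0)"
          using unit_vector_of_binary_sum_one[OF finite_atLeastAtMost bin_i bspec[OF sum1 i]]
          by blast
        then show ?thesis by blast
      qed
      then obtain \<kappa> where \<kappa>: "\<And>i. i \<in> {1..K} \<Longrightarrow> \<kappa> i \<in> {1..l i}"
        "\<And>i k. i \<in> {1..K} \<Longrightarrow> k \<in> {1..l i} \<Longrightarrow> y (i, k) = (if k = \<kappa> i then 1 else 0)"
        by metis
      have unit: "(\<Sum>i=1..K. \<Sum>k=1..l i. y (i, k) *\<^sub>R g i k) = (\<Sum>i=1..K. g i (\<kappa> i))"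
        for g :: "nat \<Rightarrow> nat \<Rightarrow> nat \<Rightarrow> real"
        using \<kappa> by (intro sum.cong[OF refl] sum_unit_vector) auto
      let ?X = "{\<Sum>i=1..K. s i | s. \<forall>i\<in>{1..K}. s i \<in> value_fibre A u (N i) (f i (\<kappa> i))}"
      have "(\<Sum>i=1..K. \<xi> i (\<kappa> i)) \<in> convex hull ?X"
        using \<xi> \<kappa>(1) by (intro sum_in_convex_hull_sums) auto
      then have "(\<Sum>i=1..K. \<xi> i (\<kappa> i), w) \<in> convex hull (?X \<times> {w})"
        by (simp add: convex_hull_Times)
      moreover have "?X \<times> {w} \<subseteq> feasible_set n d A G b u"
        using sum_fibre_points_feasible[OF disj cover _ w le[unfolded unit]] by blast
      ultimately show ?thesis
        unfolding unit by (meson hull_mono subsetD)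
    qed
    with sum_le show ?case by blast
  next
    case (combination y w y' w' a c)
    let ?s = "\<lambda>i. \<Sum>k=1..l i. y (i, k)" and ?s' = "\<lambda>i. \<Sum>k=1..l i. y' (i, k)"
    have sums: "(\<Sum>k=1..l i. (a *\<^sub>R y + c *\<^sub>R y') (i, k)) = a * ?s i + c * ?s' i" for i
      by (simp add: scaleR_fun_apply sum.distrib sum_distrib_left)
    have bounds: "a * ?s i \<le> a" "c * ?s' i \<le> c" if "i \<in> {1..K}" for i
      using combination(1-4) that by (simp_all add: mult_left_le)
    let ?\<Phi> = "\<lambda>y. \<Sum>i=1..K. \<Sum>k=1..l i. y (i, k) *\<^sub>R \<xi> i k"
    have lin: "?\<Phi> (a *\<^sub>R y + c *\<^sub>R y') = a *\<^sub>R ?\<Phi> y + c *\<^sub>R ?\<Phi> y'"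
    proof -
      have "?\<Phi> (a *\<^sub>R y + c *\<^sub>R y') =
          (\<Sum>i=1..K. \<Sum>k=1..l i. a *\<^sub>R (y (i, k) *\<^sub>R \<xi> i k) + c *\<^sub>R (y' (i, k) *\<^sub>R \<xi> i k))"
        by (intro sum.cong refl) (simp add: scaleR_fun_apply scaleR_add_left)
      then show ?thesis
        by (simp only: sum.distrib scaleR_sum_right)
    qed
    have "(?\<Phi> (a *\<^sub>R y + c *\<^sub>R y'), a *\<^sub>R w + c *\<^sub>R w') \<in> convex hull (feasible_set n d A G b u)"
      if eq: "\<forall>i\<in>{1..K}. a * ?s i + c * ?s' i = 1"
      \<comment> \<open>An endpoint of weight 0 need not lie on the face, so it is treated apart.\<close>
    proof (cases "a = 0 \<or> c = 0")
      case True
      then consider "a = 0" "c = 1" | "a = 1" "c = 0"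
        using combination(5) by fastforce
      then show ?thesis
      proof cases
        case 1
        then have "\<forall>i\<in>{1..K}. ?s' i = 1"
          using eq by simp
        then show ?thesis
          unfolding lin 1 using combination(2) by simp
      next
        case 2
        then have "\<forall>i\<in>{1..K}. ?s i = 1"
          using eq by simp
        then show ?thesis
          unfolding lin 2 using combination(1) by simp
      qed
    next
      case False
      have "a * ?s i = a \<and> c * ?s' i = c" if "i \<in> {1..K}" for i
        using bounds[OF that] bspec[OF eq that] combination(5) by linarith
      then have "\<forall>i\<in>{1..K}. ?s i = 1" "\<forall>i\<in>{1..K}. ?s' i = 1"
        using False by auto
      then have "(?\<Phi> y, w) \<in> convex hull (feasible_set n d A G b u)"
        "(?\<Phi> y', w') \<in> convex hull (feasible_set n d A G b u)"
        using combination(1,2) by simp_all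
      from convexD[OF convex_convex_hull this combination(3-5)] show ?thesis
        unfolding lin scaleR_Pair add_Pair .
    qed
    moreover have "\<forall>i\<in>{1..K}. a * ?s i + c * ?s' i \<le> 1"
    proof
      fix i assume "i \<in> {1..K}"
      from bounds[OF this] combination(5) show "a * ?s i + c * ?s' i \<le> 1" by linarith
    qed
    ultimately show ?case
      unfolding sums by (intro conjI impI)
  qed
  then show ?thesis
    using assms(5) by (elim conjE impE)
qed

section \<open>From the feasible set to the linking and aggregated polyhedra\<close>

text \<open>
  The witness \<open>y\<close> is the 0/1 vector selecting in each block the value attained by \<open>x\<close>, so every
  pair involved is already one of the points whose convex hull is taken.
\<close>

lemma feasible_selection:
  assumes disj: "disjoint_family_on N {1..K}" and cover: "(\<Union>i\<in>{1..K}. N i) = {1..n}"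
    and enum: "\<And>i. i \<in> {1..K} \<Longrightarrow> f i ` {1..l i} = block_values A u (N i)"
    and "(x, w) \<in> feasible_set n d A G b u"
  obtains y where "y \<in> coord_space (y_index K l)" "\<forall>p\<in>y_index K l. y p \<in> {0, 1}"
    "(y, w) \<in> aggregated_polyhedron d G b K l f"
    "\<forall>i\<in>{1..K}. (subvec x (N i), \<lambda>k. y (i, k)) \<in> linking_polyhedron A u (N i) (l i) (f i)"
proof -
  have x: "x \<in> coord_space {1..n}" "\<forall>j\<in>{1..n}. x j \<in> \<nat> \<and> x j \<le> real (u j)"
    and w: "w \<in> coord_space {1..d}" "\<forall>j\<in>{1..d}. 0 \<le> w j"
    and le: "(\<Sum>j=1..n. x j *\<^sub>R A j) + (\<Sum>j=1..d. w j *\<^sub>R G j) \<le> b"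
    using assms(4) by (auto simp: feasible_set_def)
  have sub: "N i \<subseteq> {1..n}" if "i \<in> {1..K}" for i
    using cover that by blast
  have "\<exists>k. k \<in> {1..l i} \<and> f i k = (\<Sum>j\<in>N i. x j *\<^sub>R A j)" if "i \<in> {1..K}" for i
  proof -
    have "(\<Sum>j\<in>N i. x j *\<^sub>R A j) \<in> f i ` {1..l i}"
      unfolding enum[OF that] using x(2) sub[OF that] by (intro block_value_of_integer_point) auto
    then obtain k where "(\<Sum>j\<in>N i. x j *\<^sub>R A j) = f i k" "k \<in> {1..l i}"
      by (rule imageE)
    then show ?thesis
      by (intro exI[of _ k] conjI) simp_all
  qed
  then obtain \<kappa> where \<kappa>: "\<And>i. i \<in> {1..K} \<Longrightarrow> \<kappa> i \<in> {1..l i}"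
    "\<And>i. i \<in> {1..K} \<Longrightarrow> f i (\<kappa> i) = (\<Sum>j\<in>N i. x j *\<^sub>R A j)"
    by metis
  define y :: "nat \<times> nat \<Rightarrow> real"
    where "y = (\<lambda>(i, k). if i \<in> {1..K} \<and> k = \<kappa> i then 1 else 0)"
  have unit: "(\<Sum>k=1..l i. y (i, k) *\<^sub>R g k) = g (\<kappa> i)" if "i \<in> {1..K}"
    for i and g :: "nat \<Rightarrow> 'z :: real_vector"
    using \<kappa>(1)[OF that] that by (intro sum_unit_vector) (auto simp: y_def)
  have sum1: "(\<Sum>k=1..l i. y (i, k)) = 1" if "i \<in> {1..K}" for i
    using unit[OF that, of "\<lambda>_. 1 :: real"] by simp
  have cs: "y \<in> coord_space (y_index K l)"
    using \<kappa>(1) by (auto simp: coord_space_def y_index_def y_def)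
  have bin: "\<forall>p. y p \<in> {0, 1}"
    by (auto simp: y_def)
  have "(\<Sum>j=1..n. x j *\<^sub>R A j) = (\<Sum>i=1..K. \<Sum>j\<in>N i. x j *\<^sub>R A j)"
    unfolding cover[symmetric] using disj finite_subset[OF sub]
    by (intro sum.UNION_disjoint) (auto simp: disjoint_family_on_def)
  also have "\<dots> = (\<Sum>i=1..K. \<Sum>k=1..l i. y (i, k) *\<^sub>R f i k)"
    by (rule sum.cong[OF refl]) (simp only: unit \<kappa>(2))
  finally have "(y, w) \<in> aggregated_polyhedron d G b K l f"
    unfolding aggregated_polyhedron_def using cs bin w le sum1
    by (intro hull_inc) auto
  moreover have "(subvec x (N i), \<lambda>k. y (i, k)) \<in> linking_polyhedron A u (N i) (l i) (f i)"
    if i: "i \<in> {1..K}" for i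
  proof -
    have "(\<Sum>j\<in>N i. subvec x (N i) j *\<^sub>R A j) = (\<Sum>k=1..l i. y (i, k) *\<^sub>R f i k)"
      using unit[OF i, of "f i"] \<kappa>(2)[OF i] by (simp add: subvec_def)
    moreover have "(\<lambda>k. y (i, k)) \<in> coord_space {1..l i}"
      using \<kappa>(1) by (auto simp: coord_space_def y_def)
    moreover have "\<forall>j\<in>N i. subvec x (N i) j \<in> \<nat> \<and> 0 \<le> subvec x (N i) j \<and>
        subvec x (N i) j \<le> real (u j)"
    proof
      fix j assume j: "j \<in> N i"
      then have "x j \<in> \<nat> \<and> x j \<le> real (u j)"
        using x(2) sub[OF i] by blast
      then show "subvec x (N i) j \<in> \<nat> \<and> 0 \<le> subvec x (N i) j \<and> subvec x (N i) j \<le> real (u j)"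
        using j by (auto simp: subvec_def Nats_def)
    qed
    ultimately show ?thesis
      unfolding linking_polyhedron_def using bin sum1[OF i]
      by (intro hull_inc) (simp add: subvec_in_coord_space)
  qed
  ultimately show thesis
    using that cs bin by blast
qed

lemma convex_linked_points:
  "convex {(x, w). x \<in> coord_space {1..n} \<and> w \<in> coord_space {1..d} \<and>
     (\<exists>y \<in> coord_space (y_index K l). (\<forall>p\<in>y_index K l. y p \<in> {0..1::real}) \<and>
        (y, w) \<in> aggregated_polyhedron d G b K l f \<and>
        (\<forall>i\<in>{1..K}. (subvec x (N i), \<lambda>k. y (i, k)) \<in> linking_polyhedron A u (N i) (l i) (f i)))}"
  (is "convex ?R")
proof (rule convexI)
  fix p q :: "(nat \<Rightarrow> real) \<times> (nat \<Rightarrow> real)" and a c :: real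
  assume pq: "p \<in> ?R" "q \<in> ?R" and ac: "0 \<le> a" "0 \<le> c" "a + c = 1"
  obtain x w y where p: "p = (x, w)" "x \<in> coord_space {1..n}" "w \<in> coord_space {1..d}"
    "y \<in> coord_space (y_index K l)" "\<forall>p\<in>y_index K l. y p \<in> {0..1}"
    "(y, w) \<in> aggregated_polyhedron d G b K l f"
    "\<forall>i\<in>{1..K}. (subvec x (N i), \<lambda>k. y (i, k)) \<in> linking_polyhedron A u (N i) (l i) (f i)"
    using pq(1) by blast
  obtain x' w' y' where q: "q = (x', w')" "x' \<in> coord_space {1..n}" "w' \<in> coord_space {1..d}"
    "y' \<in> coord_space (y_index K l)" "\<forall>p\<in>y_index K l. y' p \<in> {0..1}"
    "(y', w') \<in> aggregated_polyhedron d G b K l f"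
    "\<forall>i\<in>{1..K}. (subvec x' (N i), \<lambda>k. y' (i, k)) \<in> linking_polyhedron A u (N i) (l i) (f i)"
    using pq(2) by blast
  let ?y = "a *\<^sub>R y + c *\<^sub>R y'"
  note coord = convexD[OF convex_coord_space _ _ ac]
  have "a *\<^sub>R x + c *\<^sub>R x' \<in> coord_space {1..n}" "a *\<^sub>R w + c *\<^sub>R w' \<in> coord_space {1..d}"
    "?y \<in> coord_space (y_index K l)"
    using p(2-4) q(2-4) by (auto intro: coord)
  moreover have "?y p \<in> {0..1}" if "p \<in> y_index K l" for p
    using convexD[OF convex_real_interval(5) bspec[OF p(5) that] bspec[OF q(5) that] ac] by (simp add: scaleR_fun_apply)
  moreover have "(?y, a *\<^sub>R w + c *\<^sub>R w') \<in> aggregated_polyhedron d G b K l f"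
    using convexD[OF convex_convex_hull p(6)[unfolded aggregated_polyhedron_def]
        q(6)[unfolded aggregated_polyhedron_def] ac]
    unfolding aggregated_polyhedron_def by simp
  moreover have "(subvec (a *\<^sub>R x + c *\<^sub>R x') (N i), \<lambda>k. ?y (i, k))
      \<in> linking_polyhedron A u (N i) (l i) (f i)" if "i \<in> {1..K}" for i
  proof -
    have "(\<lambda>k. ?y (i, k)) = a *\<^sub>R (\<lambda>k. y (i, k)) + c *\<^sub>R (\<lambda>k. y' (i, k))"
      by (simp add: fun_eq_iff scaleR_fun_apply)
    then show ?thesis
      using convexD[OF convex_convex_hull bspec[OF p(7) that, unfolded linking_polyhedron_def]
          bspec[OF q(7) that, unfolded linking_polyhedron_def] ac]
      unfolding linking_polyhedron_def by (simp add: subvec_add subvec_scaleR)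
  qed
  ultimately show "a *\<^sub>R p + c *\<^sub>R q \<in> ?R"
    unfolding p(1) q(1) scaleR_Pair add_Pair
    by (intro CollectI case_prodI conjI bexI[of _ ?y] ballI)
qed

section \<open>The description by linking and aggregated polyhedra\<close>

theorem mainTheorem1:
  fixes n d m K :: nat
    and A G :: "nat \<Rightarrow> nat \<Rightarrow> real"
    and b :: "nat \<Rightarrow> real"
    and u :: "nat \<Rightarrow> nat"
    and N :: "nat \<Rightarrow> nat set"
    and l :: "nat \<Rightarrow> nat"
    and f :: "nat \<Rightarrow> nat \<Rightarrow> nat \<Rightarrow> real"
  assumes A: "\<And>j. j \<in> {1..n} \<Longrightarrow> A j \<in> coord_space {1..m}"
    and G: "\<And>j. j \<in> {1..d} \<Longrightarrow> G j \<in> coord_space {1..m}"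
    and b: "b \<in> coord_space {1..m}"
    and bounded: "euclidean_bounded n d (feasible_set n d A G b u)"
    and disjoint: "disjoint_family_on N {1..K}"
    and cover: "(\<Union>i\<in>{1..K}. N i) = {1..n}"
    and number: "\<And>i. i \<in> {1..K} \<Longrightarrow> l i = card (block_values A u (N i))"
    and enum: "\<And>i. i \<in> {1..K} \<Longrightarrow> bij_betw (f i) {1..l i} (block_values A u (N i))"
  shows "convex hull (feasible_set n d A G b u) =
    {(x, w). x \<in> coord_space {1..n} \<and> w \<in> coord_space {1..d} \<and>
       (\<exists>y \<in> coord_space (y_index K l). (\<forall>p\<in>y_index K l. y p \<in> {0..1}) \<and>
          (y, w) \<in> aggregated_polyhedron d G b K l f \<and>
          (\<forall>i\<in>{1..K}. (subvec x (N i), \<lambda>k. y (i, k)) \<in> linking_polyhedron A u (N i) (l i) (f i)))}"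
proof -
  let ?F = "feasible_set n d A G b u"
  let ?link = "\<lambda>x y. \<forall>i\<in>{1..K}.
    (subvec x (N i), \<lambda>k. y (i, k)) \<in> linking_polyhedron A u (N i) (l i) (f i)"
  let ?R = "{(x, w). x \<in> coord_space {1..n} \<and> w \<in> coord_space {1..d} \<and>
    (\<exists>y \<in> coord_space (y_index K l). (\<forall>p\<in>y_index K l. y p \<in> {0..1}) \<and>
      (y, w) \<in> aggregated_polyhedron d G b K l f \<and> ?link x y)}"
  have block_vals: "f i ` {1..l i} = block_values A u (N i)" if "i \<in> {1..K}" for i
    using enum[OF that] by (simp add: bij_betw_def)
  have "p \<in> ?R" if p: "p \<in> ?F" for p
  proof -
    obtain x w where xw: "p = (x, w)" by (cases p)
    obtain y where y: "y \<in> coord_space (y_index K l)" "\<forall>p\<in>y_index K l. y p \<in> {0, 1}"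
      "(y, w) \<in> aggregated_polyhedron d G b K l f" "?link x y"
      using feasible_selection[OF disjoint cover block_vals p[unfolded xw]] by blast
    have "\<forall>p\<in>y_index K l. y p \<in> {0..1}"
      using y(2) by fastforce
    then show ?thesis
      using y(1,3,4) p unfolding xw feasible_set_def by blast
  qed
  then have "convex hull ?F \<subseteq> ?R"
    by (intro hull_minimal convex_linked_points) blast
  moreover have "?R \<subseteq> convex hull ?F"
  proof
    fix p assume "p \<in> ?R"
    then obtain x w y where p: "p = (x, w)" "x \<in> coord_space {1..n}"
      "(y, w) \<in> aggregated_polyhedron d G b K l f" "?link x y"
      by blast
    have fibres: "value_fibre A u (N i) (f i k) \<noteq> {}" if "i \<in> {1..K}" "k \<in> {1..l i}" for i k
      using block_vals[OF that(1)] that(2) by (intro value_fibre_nonempty) blast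
    note dec = linking_polyhedron_decompose[OF bspec[OF p(4)] fibres]
    have sum1: "\<forall>i\<in>{1..K}. (\<Sum>k=1..l i. y (i, k)) = 1"
      using dec by blast
    have "\<exists>\<xi>. (\<forall>k\<in>{1..l i}. \<xi> k \<in> convex hull (value_fibre A u (N i) (f i k))) \<and>
        subvec x (N i) = (\<Sum>k=1..l i. y (i, k) *\<^sub>R \<xi> k)" if "i \<in> {1..K}" for i
      using dec[OF that that] by blast
    then obtain \<xi> where \<xi>: "\<And>i k. i \<in> {1..K} \<Longrightarrow> k \<in> {1..l i} \<Longrightarrow>
        \<xi> i k \<in> convex hull (value_fibre A u (N i) (f i k))"
      "\<And>i. i \<in> {1..K} \<Longrightarrow> subvec x (N i) = (\<Sum>k=1..l i. y (i, k) *\<^sub>R \<xi> i k)"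
      by metis
    have "x = (\<Sum>i=1..K. subvec x (N i))"
      using sum_subvec_blocks[OF _ disjoint, of x] p(2) cover by simp
    also have "\<dots> = (\<Sum>i=1..K. \<Sum>k=1..l i. y (i, k) *\<^sub>R \<xi> i k)"
      by (intro sum.cong) (simp_all add: \<xi>(2))
    finally show "p \<in> convex hull ?F"
      using aggregated_lift[OF disjoint cover \<xi>(1) p(3) sum1] p(1) by simp
  qed
  ultimately show ?thesis by (rule subset_antisym)
qed

end
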